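(* Let $\mathfrak g=\mathfrak{so}_{2r+1}(\mathbb C)$ with $r\ge 2$, and let $\lambda=\alpha_1+\alpha_2+\cdots+\alpha_r$ be the sum of its simple roots. Then $\sigma\in\mathcal A(\lambda,0)$ if and only if $\sigma=1$ or $\sigma=s_{i_1}s_{i_2}\cdots s_{i_k}$ for some nonconsecutive integers $2\le i_1,\ldots,i_k\le r$.
   Context: Let $\varepsilon_1,\ldots,\varepsilon_r$ be the standard basis of $\mathbb R^r$. The simple roots of $\mathfrak{so}_{2r+1}(\mathbb C)$ are $\alpha_i=\varepsilon_i-\varepsilon_{i+1}$ for $1\le i\le r-1$ and $\alpha_r=\varepsilon_r$; the positive roots are $\Phi^+=\{\varepsilon_i\pm\varepsilon_j:1\le i<j\le r\}\cup\{\varepsilon_i:1\le i\le r\}$. Set $\rho=\frac12\sum_{\alpha\in\Phi^+}\alpha$. The Weyl group $W$ is generated by the simple reflections $s_i$ in the hyperplanes orthogonal to $\alpha_i$, $1\le i\le r$. Kostant's partition function $\wp(\xi)$ is the number of ways to write $\xi$ as a nonnegative integral linear combination of positive roots (so $\wp(0)=1$). For weights $\lambda,\mu$, the Weyl alternation set is $\mathcal A(\lambda,\mu)=\{\sigma\in W:\wp(\sigma(\lambda+\rho)-(\mu+\rho))>0\}$. Integers $i_1,\ldots,i_k$ are nonconsecutive if $|i_a-i_b|\ge 2$ for all $a\ne b$. *)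

theory Defs
  imports "HOL-Analysis.Analysis" "HOL-Algebra.Generated_Groups" "HOL-Algebra.Bij"
begin

text \<open>
  The root system of type \<open>B\<^sub>r\<close>, i.e. of \<open>so(2r+1, C)\<close>. Throughout, \<open>e\<close> lists the standard basis
  vectors \<open>e 1, \<dots>, e r\<close> of the ambient Euclidean space. The index type of \<open>real ^ 'n\<close> carries no
  order, so the order of the basis comes from \<open>e\<close>, which is meant to satisfy
  \<open>bij_betw e {1..r} Basis\<close>.
\<close>

definition simple_root :: "nat \<Rightarrow> (nat \<Rightarrow> 'a::real_inner) \<Rightarrow> nat \<Rightarrow> 'a" where
  "simple_root r e i = (if i < r then e i - e (i + 1) else e r)"

definition positive_roots :: "nat \<Rightarrow> (nat \<Rightarrow> 'a::real_inner) \<Rightarrow> 'a set" where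
  "positive_roots r e =
     {e i - e j | i j. 1 \<le> i \<and> i < j \<and> j \<le> r} \<union>
     {e i + e j | i j. 1 \<le> i \<and> i < j \<and> j \<le> r} \<union>
     {e i | i. 1 \<le> i \<and> i \<le> r}"

definition rho :: "nat \<Rightarrow> (nat \<Rightarrow> 'a::real_inner) \<Rightarrow> 'a" where
  "rho r e = (1 / 2) *\<^sub>R (\<Sum>\<alpha>\<in>positive_roots r e. \<alpha>)"

definition reflection :: "'a::real_inner \<Rightarrow> 'a \<Rightarrow> 'a" where
  "reflection a v = v - (2 * (v \<bullet> a) / (a \<bullet> a)) *\<^sub>R a"

definition simple_reflection :: "nat \<Rightarrow> (nat \<Rightarrow> 'a::real_inner) \<Rightarrow> nat \<Rightarrow> 'a \<Rightarrow> 'a" where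
  "simple_reflection r e i = reflection (simple_root r e i)"

text \<open>
  In \<open>BijGroup UNIV\<close> the product is composition of functions and the unit is the identity map.
\<close>

definition weyl_group :: "nat \<Rightarrow> (nat \<Rightarrow> 'a::real_inner) \<Rightarrow> ('a \<Rightarrow> 'a) set" where
  "weyl_group r e = generate (BijGroup UNIV) (simple_reflection r e ` {1..r})"

text \<open>
  A way of writing \<open>\<xi>\<close> as a nonnegative integral combination of positive roots is the function
  \<open>m\<close> assigning to each positive root its coefficient; extensionality (\<open>\<rightarrow>\<^sub>E\<close>) ensures that values
  of \<open>m\<close> off the positive roots do not affect the count. The set is always finite, since the
  positive roots lie in an open half-space, so \<open>card\<close> does count it.
\<close>

definition kostant_partition :: "nat \<Rightarrow> (nat \<Rightarrow> 'a::real_inner) \<Rightarrow> 'a \<Rightarrow> nat" where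
  "kostant_partition r e \<xi> =
     card {m \<in> positive_roots r e \<rightarrow>\<^sub>E (UNIV :: nat set).
             (\<Sum>\<alpha>\<in>positive_roots r e. real (m \<alpha>) *\<^sub>R \<alpha>) = \<xi>}"

definition weyl_alternation_set ::
    "nat \<Rightarrow> (nat \<Rightarrow> 'a::real_inner) \<Rightarrow> 'a \<Rightarrow> 'a \<Rightarrow> ('a \<Rightarrow> 'a) set" where
  "weyl_alternation_set r e lam mu =
     {\<sigma> \<in> weyl_group r e.
        kostant_partition r e (\<sigma> (lam + rho r e) - (mu + rho r e)) > 0}"

definition nonconsecutive :: "nat list \<Rightarrow> bool" where
  "nonconsecutive js \<longleftrightarrow>
     (\<forall>a<length js. \<forall>b<length js. a \<noteq> b \<longrightarrow> \<bar>int (js ! a) - int (js ! b)\<bar> \<ge> 2)"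

end

theory Submission
  imports Defs
begin

text \<open>
  Put \<open>v = \<lambda> + \<rho>\<close>. Telescoping gives \<open>\<lambda> = e 1\<close>, so in the basis \<open>e 1, \<dots>, e r\<close> the coordinates of
  \<open>v\<close> are \<open>r + 1/2, r - 3/2, r - 5/2, \<dots>, 1/2\<close>: those of \<open>\<rho>\<close>, except that the first one is larger
  by 1. They are positive and strictly decreasing.

  The coefficient of \<open>x\<close> at the \<open>k\<close>-th simple root is the sum of the first \<open>k\<close> coordinates of \<open>x\<close>.
  A vector with a partition into positive roots therefore has all these partial sums in \<open>\<nat>\<close>
  (\<open>simple_coeff_nat_if_partition\<close>). Apply this to \<open>\<xi> = \<sigma> v - \<rho>\<close>. Since \<open>\<sigma>\<close> permutes
  coordinates up to sign, the partial sums of \<open>\<sigma> v\<close> are at most those of \<open>v\<close>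
  (\<open>signed_permutation_decreases_coeff\<close>), which exceed those of \<open>\<rho>\<close> by exactly 1. Hence every
  coefficient of \<open>\<xi>\<close> is 0 or 1. If \<open>S\<close> is the set of indices with coefficient 0, then
  \<open>\<xi> = \<lambda> - (\<Sum>i\<in>S. \<alpha>\<^sub>i)\<close>, that is, \<open>\<sigma> v = v - (\<Sum>i\<in>S. \<alpha>\<^sub>i)\<close>.

  Two observations on absolute values of coordinates restrict \<open>S\<close> (\<open>vanishing_coefficients\<close>).
  If \<open>1 \<in> S\<close>, then \<open>\<sigma> v\<close> has first coordinate \<open>r - 1/2\<close>, the one value that the coordinates of \<open>v\<close>
  skip. If \<open>k\<close> and \<open>k + 1\<close> lie in \<open>S\<close>, with \<open>k\<close> least possible, then the coordinates of \<open>\<sigma> v\<close> at \<open>k\<close>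
  and \<open>k + 1\<close> agree, although those of \<open>v\<close> are distinct in absolute value.

  Conversely, for \<open>j \<ge> 2\<close> the vector \<open>v\<close> pairs to 1 with the coroot of \<open>\<alpha>\<^sub>j\<close>, and \<open>\<alpha>\<^sub>i\<close>, \<open>\<alpha>\<^sub>j\<close> are
  orthogonal when \<open>i\<close> and \<open>j\<close> are nonconsecutive. So the product of the corresponding simple
  reflections sends \<open>v\<close> to \<open>v\<close> minus the sum of these \<open>\<alpha>\<^sub>j\<close> (\<open>reflection_product_on_weight\<close>), and
  what remains of \<open>\<lambda>\<close> is a sum of simple roots, which has a partition. The two directions match
  because a Weyl group element is determined by its value at \<open>v\<close> (\<open>signed_permutation_free\<close>).
\<close>

section \<open>Sums, bijection groups and nonconsecutive lists\<close>

lemma sum_in_Nats: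
  fixes f :: "'b \<Rightarrow> 'c::semiring_1"
  assumes "\<And>a. a \<in> A \<Longrightarrow> f a \<in> \<nat>"
  shows "sum f A \<in> \<nat>"
  using assms by (induction A rule: infinite_finite_induct) auto

text \<open>
  Exchange argument: \<open>J - {1..k}\<close> and \<open>{1..k} - J\<close> have the same size, and \<open>c k\<close> separates the values
  of \<open>c\<close> on the former from those on the latter.
\<close>

lemma sum_over_initial_indices_largest:
  fixes c :: "nat \<Rightarrow> real"
  assumes anti: "\<And>i j. 1 \<le> i \<Longrightarrow> i \<le> j \<Longrightarrow> j \<le> n \<Longrightarrow> c j \<le> c i"
    and J: "J \<subseteq> {1..n}" "card J = k"
  shows "sum c J \<le> sum c {1..k}"
proof (cases "k = 0")
  case True
  then show ?thesis using J finite_subset[OF J(1)] by simp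
next
  case False
  let ?K = "{1..k}"
  have fin: "finite J" using J(1) finite_subset by blast
  have kn: "k \<le> n" using card_mono[OF _ J(1)] J(2) by simp
  have card: "card (J - ?K) = card (?K - J)"
    using J(2) fin card_Diff_subset_Int[of J ?K] card_Diff_subset_Int[of ?K J] by (simp add: Int_commute)
  have "sum c (J - ?K) \<le> real (card (J - ?K)) * c k"
    using J(1) False by (intro sum_bounded_above anti) auto
  also have "\<dots> \<le> sum c (?K - J)"
    unfolding card using kn by (intro sum_bounded_below anti) auto
  finally have "sum c (J - ?K) + sum c (J \<inter> ?K) \<le> sum c (?K - J) + sum c (J \<inter> ?K)" by simp
  then show ?thesis
    using sum.Int_Diff[OF fin, of c ?K] sum.Int_Diff[of ?K c J] by (simp add: Int_commute)
qed

lemma mult_BijGroup_UNIV: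
  "f \<in> carrier (BijGroup UNIV) \<Longrightarrow> g \<in> carrier (BijGroup UNIV) \<Longrightarrow> f \<otimes>\<^bsub>BijGroup UNIV\<^esub> g = f \<circ> g"
  by (auto simp: BijGroup_def compose_def fun_eq_iff)

lemma one_BijGroup_UNIV: "\<one>\<^bsub>BijGroup UNIV\<^esub> = id"
  by (auto simp: BijGroup_def fun_eq_iff)

lemma nonconsecutive_Cons:
  assumes "nonconsecutive (j # js)"
  shows "nonconsecutive js" "i \<in> set js \<Longrightarrow> \<bar>int j - int i\<bar> \<ge> 2"
proof -
  have *: "\<bar>int ((j # js) ! a) - int ((j # js) ! b)\<bar> \<ge> 2"
    if "a < length (j # js)" "b < length (j # js)" "a \<noteq> b" for a b
    using assms that unfolding nonconsecutive_def by blast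
  show "nonconsecutive js"
    unfolding nonconsecutive_def using *[of "Suc _" "Suc _"] by auto
  show "\<bar>int j - int i\<bar> \<ge> 2" if "i \<in> set js"
    using that *[of 0 "Suc _"] by (auto simp: in_set_conv_nth)
qed

lemma nonconsecutive_sorted_list_of_set:
  assumes "finite S" "\<And>i. i \<in> S \<Longrightarrow> Suc i \<notin> S"
  shows "nonconsecutive (sorted_list_of_set S)"
proof -
  let ?l = "sorted_list_of_set S"
  have "\<bar>int (?l ! a) - int (?l ! b)\<bar> \<ge> 2" if "a < length ?l" "b < length ?l" "a \<noteq> b" for a b
  proof -
    have "?l ! a \<in> S" "?l ! b \<in> S" "?l ! a \<noteq> ?l ! b"
      using that assms(1) nth_mem[of _ ?l] by (auto simp: nth_eq_iff_index_eq simp del: nth_mem)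
    then have "Suc (?l ! a) \<noteq> ?l ! b" "Suc (?l ! b) \<noteq> ?l ! a" "?l ! a \<noteq> ?l ! b"
      using assms(2) by metis+
    then show ?thesis by linarith
  qed
  then show ?thesis unfolding nonconsecutive_def by blast
qed

section \<open>Coordinates in the basis of simple roots\<close>

locale ordered_basis =
  fixes r :: nat and e :: "nat \<Rightarrow> 'a::euclidean_space"
  assumes bij_e: "bij_betw e {1..r} Basis"
begin

lemma inner_e:
  assumes "i \<in> {1..r}" "j \<in> {1..r}"
  shows "e i \<bullet> e j = (if i = j then 1 else 0)"
proof -
  have "e i \<in> Basis" "e j \<in> Basis" "e i = e j \<longleftrightarrow> i = j"
    using assms bij_e unfolding bij_betw_def by (blast dest: inj_onD)+
  then show ?thesis by (simp add: inner_Basis)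
qed

lemma eq_by_coordinates:
  assumes "\<And>j. j \<in> {1..r} \<Longrightarrow> x \<bullet> e j = y \<bullet> e j"
  shows "x = y"
proof (rule euclidean_eqI)
  fix b :: 'a assume "b \<in> Basis"
  then obtain j where "j \<in> {1..r}" "b = e j"
    using bij_e unfolding bij_betw_def by blast
  then show "x \<bullet> b = y \<bullet> b" using assms by simp
qed

lemma simple_root_coordinate:
  assumes "k \<in> {1..r}" "j \<in> {1..r}"
  shows "simple_root r e k \<bullet> e j = (if k = j then 1 else 0) - (if k = j - 1 then 1 else 0)"
  using assms by (auto simp: simple_root_def inner_diff_left inner_e)

text \<open>
  By summation by parts these partial sums are the coefficients in the basis of simple roots;
  they are the pairings with the fundamental coweights.
\<close>

definition simple_coeff :: "nat \<Rightarrow> 'a \<Rightarrow> real" where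
  "simple_coeff k x = (\<Sum>i=1..k. x \<bullet> e i)"

lemma simple_root_sum_coordinate:
  assumes "j \<in> {1..r}"
  shows "(\<Sum>k=1..r. c k *\<^sub>R simple_root r e k) \<bullet> e j = c j - (if j = 1 then 0 else c (j - 1))"
proof -
  have "(\<Sum>k=1..r. c k *\<^sub>R simple_root r e k) \<bullet> e j
      = (\<Sum>k=1..r. (if k = j then c k else 0) - (if k = j - 1 then c k else 0))"
    unfolding inner_sum_left
    by (rule sum.cong) (use assms in \<open>auto simp: simple_root_coordinate\<close>)
  also have "\<dots> = c j - (if j = 1 then 0 else c (j - 1))"
    using assms by (auto simp: sum_subtractf sum.delta')
  finally show ?thesis .
qed

lemma simple_root_expansion:
  "x = (\<Sum>k=1..r. simple_coeff k x *\<^sub>R simple_root r e k)"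
proof (rule eq_by_coordinates)
  fix j assume j: "j \<in> {1..r}"
  then obtain i where "j = Suc i" by (cases j) auto
  then show "x \<bullet> e j = (\<Sum>k=1..r. simple_coeff k x *\<^sub>R simple_root r e k) \<bullet> e j"
    using simple_root_sum_coordinate[OF j] by (auto simp: simple_coeff_def)
qed

lemma sum_simple_roots:
  assumes "1 \<le> r"
  shows "(\<Sum>k=1..r. simple_root r e k) = e 1"
proof (rule eq_by_coordinates)
  fix j assume "j \<in> {1..r}"
  then show "(\<Sum>k=1..r. simple_root r e k) \<bullet> e j = e 1 \<bullet> e j"
    using simple_root_sum_coordinate[of j "\<lambda>_. 1"] assms by (auto simp: inner_e)
qed

lemma simple_coeff_e:
  assumes "i \<in> {1..r}" "k \<le> r"
  shows "simple_coeff k (e i) = (if i \<le> k then 1 else 0)"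
proof -
  have "simple_coeff k (e i) = (\<Sum>j=1..k. if j = i then 1 else 0)"
    unfolding simple_coeff_def by (rule sum.cong) (use assms in \<open>auto simp: inner_e\<close>)
  also have "\<dots> = (if i \<le> k then 1 else 0)" using assms by auto
  finally show ?thesis .
qed

lemma simple_coeff_add: "simple_coeff k (x + y) = simple_coeff k x + simple_coeff k y"
  by (simp add: simple_coeff_def inner_add_left sum.distrib)

lemma simple_coeff_diff: "simple_coeff k (x - y) = simple_coeff k x - simple_coeff k y"
  by (simp add: simple_coeff_def inner_diff_left sum_subtractf)

lemma simple_coeff_scaleR: "simple_coeff k (c *\<^sub>R x) = c * simple_coeff k x"
  by (simp add: simple_coeff_def sum_distrib_left)

lemma simple_coeff_sum: "simple_coeff k (\<Sum>a\<in>A. f a) = (\<Sum>a\<in>A. simple_coeff k (f a))"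
  unfolding simple_coeff_def inner_sum_left by (rule sum.swap)

section \<open>Positive roots and half their sum\<close>

definition index_pairs :: "(nat \<times> nat) set" where
  "index_pairs = Sigma {1..r} (\<lambda>i. {i<..r})"

lemma positive_roots_by_type:
  "positive_roots r e = (\<lambda>(i, j). e i - e j) ` index_pairs \<union> (\<lambda>(i, j). e i + e j) ` index_pairs
     \<union> e ` {1..r}"
  unfolding positive_roots_def index_pairs_def by force

lemma finite_positive_roots: "finite (positive_roots r e)"
  unfolding positive_roots_by_type index_pairs_def by auto

lemma simple_root_is_positive: "k \<in> {1..r} \<Longrightarrow> simple_root r e k \<in> positive_roots r e"
  unfolding positive_roots_def simple_root_def by force

text \<open>
  The three families of positive roots are disjoint and each is parametrised injectively; both are
  read off by taking inner products with the basis vectors that occur in a given root.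
\<close>

lemma sum_positive_roots:
  fixes f :: "'a \<Rightarrow> 'b::comm_monoid_add"
  shows "(\<Sum>\<alpha>\<in>positive_roots r e. f \<alpha>) =
    (\<Sum>(i, j)\<in>index_pairs. f (e i - e j)) + (\<Sum>(i, j)\<in>index_pairs. f (e i + e j)) + (\<Sum>i=1..r. f (e i))"
proof -
  let ?D = "(\<lambda>(i, j). e i - e j)" and ?S = "(\<lambda>(i, j). e i + e j)"
  have inj_D: "inj_on ?D index_pairs"
  proof (rule inj_onI, clarify)
    fix i j k l assume *: "(i, j) \<in> index_pairs" "(k, l) \<in> index_pairs" "e i - e j = e k - e l"
    then have "(e i - e j) \<bullet> e i = (e k - e l) \<bullet> e i" "(e i - e j) \<bullet> e j = (e k - e l) \<bullet> e j" by auto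
    then show "i = k \<and> j = l"
      using *(1,2) by (auto simp: index_pairs_def inner_diff_left inner_e split: if_splits)
  qed
  have inj_S: "inj_on ?S index_pairs"
  proof (rule inj_onI, clarify)
    fix i j k l assume *: "(i, j) \<in> index_pairs" "(k, l) \<in> index_pairs" "e i + e j = e k + e l"
    then have "(e i + e j) \<bullet> e i = (e k + e l) \<bullet> e i" "(e i + e j) \<bullet> e j = (e k + e l) \<bullet> e j" by auto
    then show "i = k \<and> j = l"
      using *(1,2) by (auto simp: index_pairs_def inner_add_left inner_e split: if_splits)
  qed
  have inj: "inj_on e {1..r}" using bij_e by (simp add: bij_betw_def)
  have disj1: "?D ` index_pairs \<inter> ?S ` index_pairs = {}"
  proof (clarsimp simp: disjoint_iff)
    fix i j k l assume *: "(i, j) \<in> index_pairs" "(k, l) \<in> index_pairs" "e i - e j = e k + e l"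
    then have "(e i - e j) \<bullet> e j = (e k + e l) \<bullet> e j" by auto
    then show False
      using *(1,2) by (auto simp: index_pairs_def inner_diff_left inner_add_left inner_e split: if_splits)
  qed
  have disj2: "(?D ` index_pairs \<union> ?S ` index_pairs) \<inter> e ` {1..r} = {}"
  proof -
    have False if "(i, j) \<in> index_pairs" "k \<in> {1..r}" "e i - e j = e k" for i j k
    proof -
      have "(e i - e j) \<bullet> e j = e k \<bullet> e j" using that by simp
      then show False
        using that(1,2) by (auto simp: index_pairs_def inner_diff_left inner_e split: if_splits)
    qed
    moreover have False if "(i, j) \<in> index_pairs" "k \<in> {1..r}" "e i + e j = e k" for i j k
    proof -
      have "(e i + e j) \<bullet> e i = e k \<bullet> e i" "(e i + e j) \<bullet> e j = e k \<bullet> e j" using that by simp_all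
      then show False
        using that(1,2) by (auto simp: index_pairs_def inner_add_left inner_e split: if_splits)
    qed
    ultimately show ?thesis by (auto simp: disjoint_iff) blast+
  qed
  have fin: "finite index_pairs" by (simp add: index_pairs_def)
  show ?thesis
    unfolding positive_roots_by_type
    using fin disj1 disj2
    by (simp add: sum.union_disjoint sum.reindex inj[simplified] comp_def
        case_prod_unfold inj_D[unfolded case_prod_unfold] inj_S[unfolded case_prod_unfold])
qed

lemma rho_coordinate:
  assumes k: "k \<in> {1..r}"
  shows "rho r e \<bullet> e k = real r - real k + 1 / 2"
proof -
  have "(\<Sum>\<alpha>\<in>positive_roots r e. \<alpha> \<bullet> e k)
      = (\<Sum>(i, j)\<in>index_pairs. 2 * (e i \<bullet> e k)) + (\<Sum>i=1..r. e i \<bullet> e k)"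
    unfolding sum_positive_roots
    by (simp add: case_prod_unfold sum.distrib[symmetric] inner_add_left inner_diff_left)
  also have "(\<Sum>(i, j)\<in>index_pairs. 2 * (e i \<bullet> e k)) = (\<Sum>i=1..r. \<Sum>j\<in>{i<..r}. 2 * (e i \<bullet> e k))"
    unfolding index_pairs_def by (rule sum.Sigma[symmetric]) auto
  also have "\<dots> = (\<Sum>i=1..r. if i = k then 2 * real (r - k) else 0)"
    by (rule sum.cong) (use k in \<open>auto simp: inner_e\<close>)
  also have "\<dots> = 2 * real (r - k)" using k by simp
  also have "(\<Sum>i=1..r. e i \<bullet> e k) = (\<Sum>i=1..r. if i = k then 1 else 0)"
    by (rule sum.cong) (use k in \<open>auto simp: inner_e\<close>)
  also have "\<dots> = 1" using k by simp
  finally show ?thesis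
    using k by (simp add: rho_def inner_sum_left of_nat_diff field_simps)
qed

section \<open>Positivity of the partition function\<close>

lemma simple_coeff_positive_root:
  assumes "\<alpha> \<in> positive_roots r e" "k \<le> r"
  shows "simple_coeff k \<alpha> \<in> \<nat>"
  using assms
  by (auto simp: positive_roots_def simple_coeff_add simple_coeff_diff simple_coeff_e)

lemma simple_coeff_nat_if_partition:
  assumes "kostant_partition r e \<xi> > 0" "k \<le> r"
  shows "simple_coeff k \<xi> \<in> \<nat>"
proof -
  obtain m :: "'a \<Rightarrow> nat" where "(\<Sum>\<alpha>\<in>positive_roots r e. real (m \<alpha>) *\<^sub>R \<alpha>) = \<xi>"
    using assms(1) unfolding kostant_partition_def card_gt_0_iff by blast
  then have "simple_coeff k \<xi> = (\<Sum>\<alpha>\<in>positive_roots r e. real (m \<alpha>) * simple_coeff k \<alpha>)"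
    by (auto simp: simple_coeff_sum simple_coeff_scaleR)
  also have "\<dots> \<in> \<nat>"
    using assms(2) by (intro sum_in_Nats Nats_mult simple_coeff_positive_root) auto
  finally show ?thesis .
qed

text \<open>
  This makes pairing with \<open>\<rho>\<close> a height function, which bounds the multiplicities in a partition.
\<close>

lemma rho_positive_root:
  assumes "\<alpha> \<in> positive_roots r e"
  shows "rho r e \<bullet> \<alpha> \<ge> 1 / 2"
  using assms
  by (auto simp: positive_roots_def inner_diff_right inner_add_right rho_coordinate)

text \<open>
  Pairing \<open>\<xi> = (\<Sum>\<alpha>. m \<alpha> \<alpha>)\<close> with \<open>\<rho>\<close> gives a sum of nonnegative terms, the one at \<open>\<alpha>\<close> being at least
  \<open>m \<alpha> / 2\<close>. Finiteness is what turns the existence of one partition into a positive \<open>card\<close>.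
\<close>

lemma finite_partitions:
  "finite {m \<in> positive_roots r e \<rightarrow>\<^sub>E (UNIV :: nat set).
      (\<Sum>\<alpha>\<in>positive_roots r e. real (m \<alpha>) *\<^sub>R \<alpha>) = \<xi>}"
proof (rule finite_subset)
  let ?N = "nat \<lfloor>2 * (rho r e \<bullet> \<xi>)\<rfloor>"
  show "finite (positive_roots r e \<rightarrow>\<^sub>E {..?N})"
    using finite_positive_roots by (simp add: finite_PiE)
  have "m \<alpha> \<le> ?N"
    if eq: "(\<Sum>\<alpha>\<in>positive_roots r e. real (m \<alpha>) *\<^sub>R \<alpha>) = \<xi>" and \<alpha>: "\<alpha> \<in> positive_roots r e"
    for m :: "'a \<Rightarrow> nat" and \<alpha>
  proof -
    have "real (m \<alpha>) * (1 / 2) \<le> real (m \<alpha>) * (rho r e \<bullet> \<alpha>)"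
      using rho_positive_root[OF \<alpha>] by (intro mult_left_mono) auto
    also have "\<dots> \<le> (\<Sum>\<alpha>\<in>positive_roots r e. real (m \<alpha>) * (rho r e \<bullet> \<alpha>))"
      by (rule member_le_sum[OF \<alpha>])
        (auto intro!: mult_nonneg_nonneg finite_positive_roots order_trans[OF _ rho_positive_root])
    also have "\<dots> = rho r e \<bullet> \<xi>"
      unfolding eq[symmetric] by (simp add: inner_sum_right)
    finally show ?thesis by linarith
  qed
  then show "{m \<in> positive_roots r e \<rightarrow>\<^sub>E UNIV. (\<Sum>\<alpha>\<in>positive_roots r e. real (m \<alpha>) *\<^sub>R \<alpha>) = \<xi>}
      \<subseteq> positive_roots r e \<rightarrow>\<^sub>E {..?N}"
    by (auto simp: PiE_iff extensional_def)
qed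

lemma inj_simple_root: "inj_on (simple_root r e) {1..r}"
proof (rule inj_onI)
  fix i j assume *: "i \<in> {1..r}" "j \<in> {1..r}" "simple_root r e i = simple_root r e j"
  have "simple_root r e j \<bullet> e i = 1"
    using simple_root_coordinate[of i i] * by (auto split: if_splits)
  then show "i = j" using simple_root_coordinate[of j i] * by (auto split: if_splits)
qed

lemma partition_of_simple_root_sum:
  assumes "T \<subseteq> {1..r}"
  shows "kostant_partition r e (\<Sum>i\<in>T. simple_root r e i) > 0"
proof -
  define m :: "'a \<Rightarrow> nat" where
    "m = restrict (\<lambda>\<alpha>. if \<alpha> \<in> simple_root r e ` T then 1 else 0) (positive_roots r e)"
  have sub: "simple_root r e ` T \<subseteq> positive_roots r e"
    using assms simple_root_is_positive by auto
  have "(\<Sum>\<alpha>\<in>positive_roots r e. real (m \<alpha>) *\<^sub>R \<alpha>)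
      = (\<Sum>\<alpha>\<in>positive_roots r e. if \<alpha> \<in> simple_root r e ` T then \<alpha> else 0)"
    by (rule sum.cong) (auto simp: m_def)
  also have "\<dots> = (\<Sum>\<alpha>\<in>simple_root r e ` T. \<alpha>)"
    using sub finite_positive_roots by (simp add: sum.If_cases Int_absorb1)
  also have "\<dots> = (\<Sum>i\<in>T. simple_root r e i)"
    using inj_on_subset[OF inj_simple_root assms] by (simp add: sum.reindex)
  finally have "m \<in> {m \<in> positive_roots r e \<rightarrow>\<^sub>E (UNIV :: nat set).
      (\<Sum>\<alpha>\<in>positive_roots r e. real (m \<alpha>) *\<^sub>R \<alpha>) = (\<Sum>i\<in>T. simple_root r e i)}"
    by (simp add: m_def)
  then show ?thesis
    unfolding kostant_partition_def card_gt_0_iff using finite_partitions by blast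
qed

section \<open>The Weyl group acts by signed permutations\<close>

text \<open>
  The coordinate of \<open>f x\<close> at \<open>i\<close> is, up to the sign \<open>s i\<close>, that of \<open>x\<close> at \<open>\<pi> i\<close>. Every Weyl group
  element has this form, and the form alone gives both its effect on partial sums and its
  freeness on regular vectors.
\<close>

definition signed_permutation :: "(nat \<Rightarrow> nat) \<Rightarrow> (nat \<Rightarrow> real) \<Rightarrow> ('a \<Rightarrow> 'a) \<Rightarrow> bool" where
  "signed_permutation \<pi> s f \<longleftrightarrow> bij_betw \<pi> {1..r} {1..r} \<and>
     (\<forall>i\<in>{1..r}. \<bar>s i\<bar> = 1 \<and> (\<forall>x. f x \<bullet> e i = s i * (x \<bullet> e (\<pi> i))))"

lemma signed_permutation_id: "signed_permutation id (\<lambda>_. 1) id"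
  by (simp add: signed_permutation_def)

lemma signed_permutation_comp:
  assumes "signed_permutation \<pi> s f" "signed_permutation \<pi>' s' g"
  shows "signed_permutation (\<pi>' \<circ> \<pi>) (\<lambda>i. s i * s' (\<pi> i)) (f \<circ> g)"
proof -
  have \<pi>: "\<pi> i \<in> {1..r}" if "i \<in> {1..r}" for i
    using that assms(1) unfolding signed_permutation_def bij_betw_def by blast
  have f: "\<bar>s i\<bar> = 1" "f x \<bullet> e i = s i * (x \<bullet> e (\<pi> i))"
    and g: "\<bar>s' i\<bar> = 1" "g x \<bullet> e i = s' i * (x \<bullet> e (\<pi>' i))" if "i \<in> {1..r}" for i x
    using assms that unfolding signed_permutation_def by blast+
  have "bij_betw (\<pi>' \<circ> \<pi>) {1..r} {1..r}"
    using assms by (auto simp: signed_permutation_def intro: bij_betw_trans)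
  then show ?thesis
    unfolding signed_permutation_def
    by (simp add: f g \<pi> abs_mult mult.assoc del: atLeastAtMost_iff One_nat_def)
qed

lemma simple_root_norm:
  assumes "k \<in> {1..r}"
  shows "simple_root r e k \<bullet> simple_root r e k = (if k < r then 2 else 1)"
  using assms by (auto simp: simple_root_def inner_diff_left inner_diff_right inner_e)

lemma simple_reflection_formula:
  assumes "k \<in> {1..r}"
  shows "simple_reflection r e k x =
    (if k < r then x - (x \<bullet> e k - x \<bullet> e (k + 1)) *\<^sub>R (e k - e (k + 1)) else x - (2 * (x \<bullet> e r)) *\<^sub>R e r)"
  using simple_root_norm[OF assms]
  by (auto simp: simple_reflection_def reflection_def simple_root_def inner_diff_right)

lemma simple_reflection_signed_permutation:
  assumes k: "k \<in> {1..r}"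
  shows "\<exists>\<pi> s. signed_permutation \<pi> s (simple_reflection r e k)"
proof (cases "k < r")
  case True
  let ?t = "Transposition.transpose k (k + 1)"
  have "bij_betw ?t {1..r} {1..r}"
    by (rule bij_betw_byWitness[where f' = ?t]) (use True k in \<open>auto simp: Transposition.transpose_def\<close>)
  moreover have "simple_reflection r e k x \<bullet> e i = x \<bullet> e (?t i)" if "i \<in> {1..r}" for i x
    using True k that
    by (auto simp: simple_reflection_formula inner_diff_left inner_e Transposition.transpose_def)
  ultimately have "signed_permutation ?t (\<lambda>_. 1) (simple_reflection r e k)"
    unfolding signed_permutation_def by simp
  then show ?thesis by blast
next
  case False
  then have "signed_permutation id (\<lambda>i. if i = r then - 1 else 1) (simple_reflection r e k)"
    using k unfolding signed_permutation_def
    by (auto simp: simple_reflection_formula inner_diff_left inner_e)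
  then show ?thesis by blast
qed

lemma simple_reflection_involution:
  assumes "k \<in> {1..r}"
  shows "simple_reflection r e k (simple_reflection r e k x) = x"
proof -
  have "simple_root r e k \<bullet> simple_root r e k \<noteq> 0" using simple_root_norm[OF assms] by simp
  then show ?thesis
    by (simp add: simple_reflection_def reflection_def inner_diff_left algebra_simps)
qed

lemma simple_reflection_in_BijGroup:
  assumes "k \<in> {1..r}"
  shows "simple_reflection r e k \<in> carrier (BijGroup UNIV)"
  using o_bij[of "simple_reflection r e k" "simple_reflection r e k"]
    simple_reflection_involution[OF assms]
  by (simp add: BijGroup_def Bij_def extensional_def fun_eq_iff)

lemma weyl_group_in_BijGroup: "\<sigma> \<in> weyl_group r e \<Longrightarrow> \<sigma> \<in> carrier (BijGroup UNIV)"
  unfolding weyl_group_def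
  by (rule group.generate_in_carrier[OF group_BijGroup])
    (use simple_reflection_in_BijGroup in auto)

lemma weyl_group_signed_permutation:
  assumes "\<sigma> \<in> weyl_group r e"
  shows "\<exists>\<pi> s. signed_permutation \<pi> s \<sigma>"
  using assms[unfolded weyl_group_def]
proof (induction rule: generate.induct)
  case one
  then show ?case using signed_permutation_id one_BijGroup_UNIV by metis
next
  case (incl h)
  then show ?case using simple_reflection_signed_permutation by auto
next
  case (inv h)
  then obtain k where k: "k \<in> {1..r}" "h = simple_reflection r e k" by auto
  then have h: "h \<in> carrier (BijGroup UNIV)" using simple_reflection_in_BijGroup by blast
  have "h \<circ> h = id" using simple_reflection_involution k by fastforce
  then have "inv\<^bsub>BijGroup UNIV\<^esub> h = h"
    using h by (intro group.inv_equality[OF group_BijGroup])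
      (simp_all add: mult_BijGroup_UNIV one_BijGroup_UNIV)
  then show ?case using simple_reflection_signed_permutation k by metis
next
  case (eng g h)
  then have "g \<otimes>\<^bsub>BijGroup UNIV\<^esub> h = g \<circ> h"
    using weyl_group_in_BijGroup unfolding weyl_group_def by (intro mult_BijGroup_UNIV) auto
  then show ?case using eng.IH signed_permutation_comp by metis
qed

lemma reflection_product_in_weyl_group:
  assumes "set js \<subseteq> {1..r}"
  shows "foldr (\<circ>) (map (simple_reflection r e) js) id \<in> weyl_group r e"
  using assms
proof (induction js)
  case Nil
  then show ?case
    using generate.one[of "BijGroup UNIV"] by (simp add: weyl_group_def one_BijGroup_UNIV id_def)
next
  case (Cons j js)
  let ?\<tau> = "foldr (\<circ>) (map (simple_reflection r e) js) id"
  have "simple_reflection r e j \<in> weyl_group r e"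
    using Cons.prems by (simp add: weyl_group_def generate.incl)
  moreover have "?\<tau> \<in> weyl_group r e"
    by (rule Cons.IH) (use Cons.prems in simp)
  ultimately have "simple_reflection r e j \<otimes>\<^bsub>BijGroup UNIV\<^esub> ?\<tau> \<in> weyl_group r e"
    unfolding weyl_group_def by (rule generate.eng)
  also have "simple_reflection r e j \<otimes>\<^bsub>BijGroup UNIV\<^esub> ?\<tau> = simple_reflection r e j \<circ> ?\<tau>"
    using Cons.prems weyl_group_in_BijGroup[OF \<open>?\<tau> \<in> weyl_group r e\<close>]
    by (intro mult_BijGroup_UNIV simple_reflection_in_BijGroup) simp_all
  finally show ?case
    by (simp only: list.map foldr.simps comp_apply[where f = "(\<circ>) (simple_reflection r e j)"])
qed

text \<open>
  At \<open>v\<close>, whose coordinates are positive and distinct, a coordinate of \<open>f v\<close> reveals through its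
  absolute value where it came from, and through its sign the sign \<open>s j\<close>.
\<close>

lemma signed_permutation_free:
  assumes "signed_permutation \<pi> s f" "signed_permutation \<pi>' s' g" "f v = g v"
    and pos: "\<And>i. i \<in> {1..r} \<Longrightarrow> v \<bullet> e i > 0" and inj: "inj_on (\<lambda>i. v \<bullet> e i) {1..r}"
  shows "f = g"
proof (rule ext, rule eq_by_coordinates)
  fix x j assume j: "j \<in> {1..r}"
  have \<pi>j: "\<pi> j \<in> {1..r}" "\<pi>' j \<in> {1..r}"
    using j assms(1,2) unfolding signed_permutation_def bij_betw_def by blast+
  have s: "\<bar>s j\<bar> = 1" "\<bar>s' j\<bar> = 1"
    and f: "\<And>x. f x \<bullet> e j = s j * (x \<bullet> e (\<pi> j))" and g: "\<And>x. g x \<bullet> e j = s' j * (x \<bullet> e (\<pi>' j))"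
    using j assms(1,2) unfolding signed_permutation_def by blast+
  have eq: "s j * (v \<bullet> e (\<pi> j)) = s' j * (v \<bullet> e (\<pi>' j))" using f g assms(3) by metis
  then have "\<bar>s j\<bar> * \<bar>v \<bullet> e (\<pi> j)\<bar> = \<bar>s' j\<bar> * \<bar>v \<bullet> e (\<pi>' j)\<bar>" by (metis abs_mult)
  then have "v \<bullet> e (\<pi> j) = v \<bullet> e (\<pi>' j)" using s pos[OF \<pi>j(1)] pos[OF \<pi>j(2)] by simp
  then have "\<pi> j = \<pi>' j" using inj \<pi>j by (auto dest: inj_onD)
  moreover have "s j = s' j" using eq \<open>\<pi> j = \<pi>' j\<close> pos[OF \<pi>j(1)] by simp
  ultimately show "f x \<bullet> e j = g x \<bullet> e j" using f g by simp
qed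

text \<open>
  The instance of \<open>w v \<le> v\<close> in the dominance order, for \<open>v\<close> dominant: dropping the signs only
  increases a partial sum, and then it is a sum of \<open>k\<close> coordinates of \<open>v\<close>, at most that of the \<open>k\<close>
  largest ones.
\<close>

lemma signed_permutation_decreases_coeff:
  assumes f: "signed_permutation \<pi> s f" and k: "k \<le> r"
    and nonneg: "\<And>i. i \<in> {1..r} \<Longrightarrow> 0 \<le> v \<bullet> e i"
    and anti: "\<And>i j. 1 \<le> i \<Longrightarrow> i \<le> j \<Longrightarrow> j \<le> r \<Longrightarrow> v \<bullet> e j \<le> v \<bullet> e i"
  shows "simple_coeff k (f v) \<le> simple_coeff k v"
proof -
  have sub: "{1..k} \<subseteq> {1..r}" using k by auto
  have \<pi>: "inj_on \<pi> {1..k}" "\<pi> ` {1..k} \<subseteq> {1..r}"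
    using f sub unfolding signed_permutation_def bij_betw_def by (blast intro: inj_on_subset)+
  have "simple_coeff k (f v) \<le> (\<Sum>i=1..k. v \<bullet> e (\<pi> i))"
    unfolding simple_coeff_def
  proof (rule sum_mono)
    fix i assume i: "i \<in> {1..k}"
    then have "\<bar>s i\<bar> = 1" "f v \<bullet> e i = s i * (v \<bullet> e (\<pi> i))" "0 \<le> v \<bullet> e (\<pi> i)"
      using f sub \<pi>(2) nonneg unfolding signed_permutation_def by blast+
    then show "f v \<bullet> e i \<le> v \<bullet> e (\<pi> i)" by (simp add: abs_if split: if_splits)
  qed
  also have "\<dots> = (\<Sum>i\<in>\<pi> ` {1..k}. v \<bullet> e i)" using \<pi>(1) by (simp add: sum.reindex)
  also have "\<dots> \<le> (\<Sum>i=1..k. v \<bullet> e i)"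
    using \<pi> by (intro sum_over_initial_indices_largest[where n = r] anti) (auto simp: card_image)
  finally show ?thesis by (simp add: simple_coeff_def)
qed

section \<open>Products of commuting simple reflections\<close>

lemma simple_roots_orthogonal:
  assumes "i \<in> {1..r}" "j \<in> {1..r}" "\<bar>int i - int j\<bar> \<ge> 2"
  shows "simple_root r e i \<bullet> simple_root r e j = 0"
  using assms by (auto simp: simple_root_def inner_diff_left inner_diff_right inner_e)

text \<open>
  The hypothesis on \<open>v\<close> says that it pairs to 1 with each coroot involved, so a single reflection
  subtracts its root. By orthogonality the roots subtracted before do not change that pairing.
\<close>

lemma reflection_product_on_weight:
  assumes "nonconsecutive js" "set js \<subseteq> {1..r}"
    and v: "\<And>j. j \<in> set js \<Longrightarrow>
      2 * (v \<bullet> simple_root r e j) = simple_root r e j \<bullet> simple_root r e j"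
  shows "foldr (\<circ>) (map (simple_reflection r e) js) id v = v - (\<Sum>j\<in>set js. simple_root r e j)"
  using assms
proof (induction js)
  case Nil
  then show ?case by simp
next
  case (Cons j js)
  note nc = nonconsecutive_Cons[OF Cons.prems(1)]
  let ?a = "simple_root r e j" and ?S = "\<Sum>i\<in>set js. simple_root r e i"
  have j: "j \<in> {1..r}" "j \<notin> set js" using Cons.prems(2) nc(2)[of j] by auto
  have "?S \<bullet> ?a = 0"
    unfolding inner_sum_left
    using Cons.prems(2) nc(2) by (intro sum.neutral ballI simple_roots_orthogonal) fastforce+
  moreover have "2 * (v \<bullet> ?a) = ?a \<bullet> ?a" "?a \<bullet> ?a \<noteq> 0"
    using Cons.prems(3) simple_root_norm[OF j(1)] by auto
  ultimately have "simple_reflection r e j (v - ?S) = v - ?S - ?a"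
    by (simp add: simple_reflection_def reflection_def inner_diff_left)
  then show ?case
    using Cons.IH[OF nc(1)] Cons.prems(2,3) j(2) by simp
qed

section \<open>The Weyl orbit of the shifted highest short root\<close>

context
  assumes rank: "2 \<le> r"
begin

definition shifted_weight :: 'a where
  "shifted_weight = e 1 + rho r e"

lemma shifted_weight_coordinate:
  "i \<in> {1..r} \<Longrightarrow> shifted_weight \<bullet> e i = real r - real i + (if i = 1 then 3 / 2 else 1 / 2)"
  using rank by (auto simp: shifted_weight_def inner_add_left inner_e rho_coordinate)

lemma inj_shifted_weight: "inj_on (\<lambda>i. shifted_weight \<bullet> e i) {1..r}"
  by (rule inj_onI) (auto simp: shifted_weight_coordinate split: if_splits)

text \<open>
  For \<open>j = 1\<close> the equation fails: the first two coordinates differ by 2, so the first reflection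
  would subtract its root twice, more often than it occurs in \<open>\<lambda>\<close>.
\<close>

lemma shifted_weight_simple_root:
  assumes "j \<in> {2..r}"
  shows "2 * (shifted_weight \<bullet> simple_root r e j) = simple_root r e j \<bullet> simple_root r e j"
proof -
  have "j \<in> {1..r}" using assms by simp
  then show ?thesis
    using assms shifted_weight_coordinate[of j] shifted_weight_coordinate[of "j + 1"]
    unfolding simple_root_norm[OF \<open>j \<in> {1..r}\<close>]
    by (auto simp: simple_root_def inner_diff_right)
qed

text \<open>
  Integrality and dominance force each coefficient of \<open>f v - \<rho>\<close> to be 0 or 1, \<open>v\<close> being the shifted
  weight; \<open>S\<close> consists of the indices where it is 0. That \<open>S\<close> omits 1 and has no two consecutive
  members comes from the coordinates of \<open>v\<close> being permuted up to sign.
\<close>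

lemma vanishing_coefficients:
  assumes f: "signed_permutation \<pi> s f"
    and nat: "\<And>k. k \<le> r \<Longrightarrow> simple_coeff k (f shifted_weight - rho r e) \<in> \<nat>"
  shows "\<exists>S \<subseteq> {2..r}. (\<forall>i\<in>S. Suc i \<notin> S) \<and>
    f shifted_weight = shifted_weight - (\<Sum>i\<in>S. simple_root r e i)"
proof -
  define v where "v = shifted_weight"
  define \<xi> where "\<xi> = f v - rho r e"
  define c where "c k = simple_coeff k \<xi>" for k
  define S where "S = {k \<in> {1..r}. c k = 0}"
  have c01: "c k = (if k \<in> S then 0 else 1)" if k: "k \<in> {1..r}" for k
  proof -
    have "simple_coeff k (f v) \<le> simple_coeff k v"
      by (rule signed_permutation_decreases_coeff[OF f])
        (use k in \<open>auto simp: v_def shifted_weight_coordinate\<close>)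
    then have "c k \<le> 1"
      using k rank
      by (simp add: c_def \<xi>_def v_def shifted_weight_def simple_coeff_diff simple_coeff_add
          simple_coeff_e)
    moreover have "c k \<in> \<nat>" using nat[of k] k by (simp add: c_def \<xi>_def v_def)
    then obtain n where "c k = real n" by (auto elim: Nats_cases)
    ultimately have "c k = 0 \<or> c k = 1" by (cases n) auto
    then show ?thesis using k by (auto simp: S_def)
  qed
  have coord: "f v \<bullet> e (Suc k) = real r - real k - 1 / 2 + c (Suc k) - c k" if "Suc k \<le> r" for k
    using that rho_coordinate[of "Suc k"] by (simp add: c_def simple_coeff_def \<xi>_def inner_diff_left)
  have c0: "c 0 = 0" by (simp add: c_def simple_coeff_def)
  have moved: "\<bar>s j\<bar> = 1" "f v \<bullet> e j = s j * (v \<bullet> e (\<pi> j))" "\<pi> j \<in> {1..r}" if "j \<in> {1..r}" for j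
    using f that unfolding signed_permutation_def bij_betw_def by blast+
  \<comment> \<open>The coordinates of \<open>v\<close> jump from \<open>r + 1/2\<close> to \<open>r - 3/2\<close>, while \<open>f v\<close> would start with \<open>r - 1/2\<close>.\<close>
  have "1 \<notin> S"
  proof
    assume "1 \<in> S"
    then have "f v \<bullet> e 1 = real r - 1 / 2" using coord[of 0] c0 rank by (simp add: S_def)
    moreover have "\<bar>f v \<bullet> e 1\<bar> = v \<bullet> e (\<pi> 1)"
      using moved[of 1] rank by (auto simp: abs_mult v_def shifted_weight_coordinate)
    ultimately have "v \<bullet> e (\<pi> 1) = real r - 1 / 2" using rank by simp
    then show False
      using moved(3)[of 1] rank by (auto simp: v_def shifted_weight_coordinate split: if_splits)
  qed
  have step: "Suc k \<notin> S" if "k \<in> S" for k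
    using that
  proof (induction k rule: less_induct)
    case (less k)
    show ?case
    proof
      assume Suck: "Suc k \<in> S"
      have k: "k \<in> {2..r}" "k \<noteq> 0"
        using less.prems \<open>1 \<notin> S\<close> by (auto simp: S_def dest: le_neq_implies_less)
      then obtain l where l: "k = Suc l" by (cases k) auto
      have lr: "l \<in> {1..r}" using k l by auto
      have "l \<notin> S" using less.IH[of l] l less.prems by blast
      then have "c l = 1" using c01[OF lr] by simp
      moreover have "c k = 0" "c (Suc k) = 0" "Suc k \<le> r" using less.prems Suck by (auto simp: S_def)
      \<comment> \<open>\<open>f v\<close> is one less than \<open>\<rho>\<close> at \<open>k\<close> and equals \<open>\<rho>\<close> at \<open>k + 1\<close>; \<open>\<rho>\<close> itself drops by one there.\<close>
      ultimately have eq: "f v \<bullet> e k = f v \<bullet> e (Suc k)"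
        using coord[of l] coord[of k] k l by simp
      have kr: "k \<in> {1..r}" "Suc k \<in> {1..r}" using k Suck by (auto simp: S_def)
      have "\<bar>f v \<bullet> e j\<bar> = v \<bullet> e (\<pi> j)" if "j \<in> {1..r}" for j
        using moved[OF that] by (auto simp: abs_mult v_def shifted_weight_coordinate)
      then have "v \<bullet> e (\<pi> k) = v \<bullet> e (\<pi> (Suc k))" using eq kr by metis
      then have "\<pi> k = \<pi> (Suc k)"
        using inj_shifted_weight moved(3) kr by (auto simp: v_def dest: inj_onD)
      then show False
        using f kr unfolding signed_permutation_def bij_betw_def by (auto dest: inj_onD)
    qed
  qed
  have "\<xi> = (\<Sum>k=1..r. c k *\<^sub>R simple_root r e k)"
    unfolding c_def by (rule simple_root_expansion)
  also have "\<dots> = (\<Sum>k=1..r. simple_root r e k - (if k \<in> S then simple_root r e k else 0))"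
    by (rule sum.cong) (auto simp: c01)
  also have "\<dots> = e 1 - (\<Sum>i\<in>S. simple_root r e i)"
  proof -
    have "{1..r} \<inter> S = S" by (auto simp: S_def)
    then show ?thesis
      using rank sum_simple_roots by (simp add: sum_subtractf sum.If_cases)
  qed
  finally have "f v = v - (\<Sum>i\<in>S. simple_root r e i)"
    by (simp add: \<xi>_def v_def shifted_weight_def algebra_simps)
  moreover have "S \<subseteq> {2..r}"
  proof
    fix k assume "k \<in> S"
    moreover from this have "k \<noteq> 1" using \<open>1 \<notin> S\<close> by auto
    ultimately show "k \<in> {2..r}" by (auto simp: S_def)
  qed
  ultimately show ?thesis using step unfolding v_def by blast
qed

lemma mem_weyl_alternation_set_iff:
  "\<sigma> \<in> weyl_alternation_set r e (e 1) 0 \<longleftrightarrow>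
     (\<exists>js. set js \<subseteq> {2..r} \<and> nonconsecutive js \<and>
           \<sigma> = foldr (\<circ>) (map (simple_reflection r e) js) id)"
proof
  assume "\<sigma> \<in> weyl_alternation_set r e (e 1) 0"
  then have \<sigma>: "\<sigma> \<in> weyl_group r e"
    and part: "kostant_partition r e (\<sigma> shifted_weight - rho r e) > 0"
    by (simp_all add: weyl_alternation_set_def shifted_weight_def)
  obtain \<pi> s where sp: "signed_permutation \<pi> s \<sigma>" using weyl_group_signed_permutation[OF \<sigma>] by blast
  obtain S where S: "S \<subseteq> {2..r}" "\<forall>i\<in>S. Suc i \<notin> S"
    "\<sigma> shifted_weight = shifted_weight - (\<Sum>i\<in>S. simple_root r e i)"
    using vanishing_coefficients[OF sp] simple_coeff_nat_if_partition[OF part] by blast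
  define js where "js = sorted_list_of_set S"
  have fin: "finite S" using S(1) finite_subset by blast
  have set: "set js = S" and nc: "nonconsecutive js"
    unfolding js_def using fin S(2) by (auto intro!: nonconsecutive_sorted_list_of_set)
  let ?\<tau> = "foldr (\<circ>) (map (simple_reflection r e) js) id"
  have sub: "set js \<subseteq> {1..r}" using S(1) set by auto
  obtain \<pi>' s' where sp': "signed_permutation \<pi>' s' ?\<tau>"
    using weyl_group_signed_permutation[OF reflection_product_in_weyl_group[OF sub]] by blast
  have "\<sigma> shifted_weight = ?\<tau> shifted_weight"
    using S(1) unfolding S(3) set[symmetric]
    by (intro reflection_product_on_weight[OF nc sub, symmetric] shifted_weight_simple_root) auto
  then have "\<sigma> = ?\<tau>"
    by (rule signed_permutation_free[OF sp sp' _ _ inj_shifted_weight])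
      (auto simp: shifted_weight_coordinate)
  then show "\<exists>js. set js \<subseteq> {2..r} \<and> nonconsecutive js \<and>
      \<sigma> = foldr (\<circ>) (map (simple_reflection r e) js) id"
    using set S(1) nc by blast
next
  assume "\<exists>js. set js \<subseteq> {2..r} \<and> nonconsecutive js \<and>
      \<sigma> = foldr (\<circ>) (map (simple_reflection r e) js) id"
  then obtain js where js: "set js \<subseteq> {2..r}" "nonconsecutive js"
    and \<sigma>: "\<sigma> = foldr (\<circ>) (map (simple_reflection r e) js) id" by blast
  have sub: "set js \<subseteq> {1..r}" using js(1) by auto
  have "\<sigma> shifted_weight = shifted_weight - (\<Sum>i\<in>set js. simple_root r e i)"
    unfolding \<sigma> using js(1)
    by (intro reflection_product_on_weight[OF js(2) sub] shifted_weight_simple_root) auto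
  then have "\<sigma> shifted_weight - rho r e = e 1 - (\<Sum>i\<in>set js. simple_root r e i)"
    by (simp add: shifted_weight_def)
  also have "\<dots> = (\<Sum>i\<in>{1..r} - set js. simple_root r e i)"
    using sub rank sum_simple_roots by (simp add: sum_diff)
  finally have "kostant_partition r e (\<sigma> shifted_weight - rho r e) > 0"
    by (simp add: partition_of_simple_root_sum)
  then show "\<sigma> \<in> weyl_alternation_set r e (e 1) 0"
    using reflection_product_in_weyl_group[OF sub] \<sigma> by (simp add: weyl_alternation_set_def shifted_weight_def)
qed

end

end

theorem theorem2p1:
  fixes r :: nat
    and e :: "nat \<Rightarrow> real ^ 'n"
    and \<sigma> :: "real ^ 'n \<Rightarrow> real ^ 'n"
  assumes "r \<ge> 2"
    and "bij_betw e {1..r} Basis"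
  shows "\<sigma> \<in> weyl_alternation_set r e (\<Sum>i=1..r. simple_root r e i) 0 \<longleftrightarrow>
           \<sigma> = id \<or>
           (\<exists>js. js \<noteq> [] \<and> set js \<subseteq> {2..r} \<and> nonconsecutive js \<and>
                 \<sigma> = foldr (\<circ>) (map (simple_reflection r e) js) id)"
proof -
  interpret ordered_basis r e using assms(2) by unfold_locales
  have sum: "(\<Sum>i=1..r. simple_root r e i) = e 1" using assms(1) by (intro sum_simple_roots) simp
  have "nonconsecutive []" "foldr (\<circ>) (map (simple_reflection r e) []) id = id"
    by (simp_all add: nonconsecutive_def)
  then show ?thesis
    unfolding sum mem_weyl_alternation_set_iff[OF assms(1)] by (metis list.set(1) empty_subsetI)
qed

end
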